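(* Let $1\le q\le\alpha\le p\le\infty$. There is a constant $C>0$ such that $${}_{r}\|f\|_{q,p,\alpha}\le C\,\|f\|_\alpha$$ for all $f\in L_0(X)$ and all real numbers $r>0$.
   Context: Setting. $(X,d,\mu)$ is a space of homogeneous type: $d$ is a quasi-metric on $X$ (with a constant $\kappa\ge 1$ such that $d(x,y)\le\kappa(d(x,z)+d(z,y))$ for all $x,y,z\in X$), and $\mu$ is a non-negative Borel measure such that, with $B(x,r)=\{y\in X: d(x,y)<r\}$, there is a constant $C$ with $0<\mu(B(x,2r))\le C\mu(B(x,r))<\infty$ for all $x\in X$, $r>0$. It is assumed moreover that all balls $B(x,r)$ are open for the $d$-topology, $(X,d)$ is separable, $\mu(X)=\infty$, and $B(x,R)\setminus B(x,r)\neq\emptyset$ for all $x\in X$ and $0<r<R<\infty$. Notation. $L_0(X)$ is the complex vector space of classes (modulo equality $\mu$-almost everywhere) of $\mu$-measurable complex-valued functions on $X$; $\|\cdot\|_s$ is the usual norm of $L^s(X)=L^s(X,\mu)$ (with value $\infty$ outside $L^s(X)$); $\chi_E$ is the characteristic function of $E$. For $f\in L_0(X)$ and $r>0$ (convention $1/\infty=0$), $${}_{r}\|f\|_{q,p,\alpha}=\left[\int_X\left(\mu(B(y,r))^{\frac1\alpha-\frac1p-\frac1q}\,\|f\chi_{B(y,r)}\|_q\right)^p d\mu(y)\right]^{1/p}\quad\text{if } p<\infty,$$ $${}_{r}\|f\|_{q,\infty,\alpha}=\sup_{y\in X}\mu(B(y,r))^{\frac1\alpha-\frac1q}\,\|f\chi_{B(y,r)}\|_q\quad\text{if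 } p=\infty.$$ *)

theory Defs
  imports "HOL-Analysis.Analysis" "HOL-Probability.Essential_Supremum"
begin

section \<open>Quasi-metric spaces\<close>

locale quasi_metric_space =
  fixes X :: "'a set" and d :: "'a \<Rightarrow> 'a \<Rightarrow> real"
  assumes nonneg: "x \<in> X \<Longrightarrow> y \<in> X \<Longrightarrow> 0 \<le> d x y"
    and eq_0_iff: "x \<in> X \<Longrightarrow> y \<in> X \<Longrightarrow> d x y = 0 \<longleftrightarrow> x = y"
    and sym: "x \<in> X \<Longrightarrow> y \<in> X \<Longrightarrow> d x y = d y x"
    and quasi_triangle:
      "\<exists>\<kappa>\<ge>1. \<forall>x\<in>X. \<forall>y\<in>X. \<forall>z\<in>X. d x y \<le> \<kappa> * (d x z + d z y)"

definition qball :: "'a set \<Rightarrow> ('a \<Rightarrow> 'a \<Rightarrow> real) \<Rightarrow> 'a \<Rightarrow> real \<Rightarrow> 'a set" where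
  "qball X d x r = {y \<in> X. d x y < r}"

definition qtopology :: "'a set \<Rightarrow> ('a \<Rightarrow> 'a \<Rightarrow> real) \<Rightarrow> 'a topology" where
  "qtopology X d = topology (\<lambda>U. U \<subseteq> X \<and> (\<forall>x\<in>U. \<exists>r>0. qball X d x r \<subseteq> U))"

lemma openin_qtopology:
  "openin (qtopology X d) U \<longleftrightarrow> U \<subseteq> X \<and> (\<forall>x\<in>U. \<exists>r>0. qball X d x r \<subseteq> U)"
proof -
  have "istopology (\<lambda>U. U \<subseteq> X \<and> (\<forall>x\<in>U. \<exists>r>0. qball X d x r \<subseteq> U))"
    unfolding istopology_def
  proof (intro conjI allI impI)
    fix S T
    assume S: "S \<subseteq> X \<and> (\<forall>x\<in>S. \<exists>r>0. qball X d x r \<subseteq> S)"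
      and T: "T \<subseteq> X \<and> (\<forall>x\<in>T. \<exists>r>0. qball X d x r \<subseteq> T)"
    show "S \<inter> T \<subseteq> X" using S by blast
    show "\<forall>x\<in>S \<inter> T. \<exists>r>0. qball X d x r \<subseteq> S \<inter> T"
    proof
      fix x assume "x \<in> S \<inter> T"
      then obtain r s where "r > 0" "qball X d x r \<subseteq> S" "s > 0" "qball X d x s \<subseteq> T"
        using S T by blast
      then show "\<exists>r>0. qball X d x r \<subseteq> S \<inter> T"
        by (intro exI[of _ "min r s"]) (auto simp: qball_def)
    qed
  qed (meson Sup_least Sup_upper UnionE order.trans)+
  then show ?thesis by (simp add: qtopology_def)
qed

lemma topspace_qtopology [simp]: "topspace (qtopology X d) = X"
proof
  have "openin (qtopology X d) X"
    unfolding openin_qtopology by (auto simp: qball_def intro: exI[of _ 1])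
  then show "X \<subseteq> topspace (qtopology X d)" by (rule openin_subset)
  show "topspace (qtopology X d) \<subseteq> X"
    using openin_topspace[of "qtopology X d"] unfolding openin_qtopology by blast
qed

section \<open>Spaces of homogeneous type\<close>

text \<open>The underlying set \<open>X\<close> is \<^term>\<open>space M\<close>, and \<open>\<mu>\<close> is \<^term>\<open>M\<close>.\<close>

locale homogeneous_type_space =
  quasi_metric_space "space M" d for M :: "'a measure" and d :: "'a \<Rightarrow> 'a \<Rightarrow> real" +
  assumes sets_eq_borel: "sets M = sigma_sets (space M) {U. openin (qtopology (space M) d) U}"
    and doubling: "\<exists>C::real. \<forall>x\<in>space M. \<forall>r>0.
      0 < emeasure M (qball (space M) d x (2 * r)) \<and>
      emeasure M (qball (space M) d x (2 * r)) \<le> ennreal C * emeasure M (qball (space M) d x r) \<and>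
      ennreal C * emeasure M (qball (space M) d x r) < \<infinity>"
    and openin_qball: "x \<in> space M \<Longrightarrow> 0 < r \<Longrightarrow>
      openin (qtopology (space M) d) (qball (space M) d x r)"
    and separable: "separable_space (qtopology (space M) d)"
    and emeasure_space_infinite: "emeasure M (space M) = \<infinity>"
    and annulus_nonempty: "x \<in> space M \<Longrightarrow> 0 < r \<Longrightarrow> r < R \<Longrightarrow>
      qball (space M) d x R - qball (space M) d x r \<noteq> {}"

section \<open>Norms\<close>

text \<open>Exponents in \<open>[1, \<infinity>]\<close> have type \<^typ>\<open>ennreal\<close>; \<open>recip s\<close> is the real number
  \<open>1 / s\<close>, with \<open>recip \<infinity> = 0\<close>.\<close>

definition recip :: "ennreal \<Rightarrow> real" where
  "recip s = enn2real (1 / s)"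

text \<open>Real powers on \<open>[0, \<infinity>]\<close>, only meant for exponents \<open>a > 0\<close>.\<close>

definition ennpowr :: "ennreal \<Rightarrow> real \<Rightarrow> ennreal" where
  "ennpowr x a = (if x = \<infinity> then \<infinity> else ennreal (enn2real x powr a))"

text \<open>Elements of \<open>L\<^sub>0(X)\<close> are represented by functions measurable for the completed measure;
  the norms do not depend on the representative, see \<open>Lnorm_cong_AE\<close> and
  \<open>amalgam_norm_cong_AE\<close> below. The completion matters only for \<^const>\<open>esssup\<close>, which is
  infinite by definition on non-measurable functions.\<close>

definition L0 :: "'a measure \<Rightarrow> ('a \<Rightarrow> complex) set" where
  "L0 M = borel_measurable (completion M)"

definition Lnorm :: "'a measure \<Rightarrow> ennreal \<Rightarrow> ('a \<Rightarrow> complex) \<Rightarrow> ennreal" where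
  "Lnorm M s f =
    (if s = \<infinity> then esssup (completion M) (\<lambda>x. ennreal (norm (f x)))
     else ennpowr (\<integral>\<^sup>+x. ennreal (norm (f x) powr enn2real s) \<partial>completion M) (recip s))"

definition amalgam_norm ::
  "'a measure \<Rightarrow> ('a \<Rightarrow> 'a \<Rightarrow> real) \<Rightarrow> real \<Rightarrow> ennreal \<Rightarrow> ennreal \<Rightarrow> ennreal \<Rightarrow> ('a \<Rightarrow> complex) \<Rightarrow> ennreal"
where
  "amalgam_norm M d r q p \<alpha> f =
    (let B = (\<lambda>y. qball (space M) d y r) in
     if p = \<infinity> then
       (SUP y\<in>space M. ennreal (measure M (B y) powr (recip \<alpha> - recip q)) *
          Lnorm M q (\<lambda>x. f x * indicator (B y) x))
     else
       ennpowr (\<integral>\<^sup>+y. ennpowr (ennreal (measure M (B y) powr (recip \<alpha> - recip p - recip q)) *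
          Lnorm M q (\<lambda>x. f x * indicator (B y) x)) (enn2real p) \<partial>M) (recip p))"

lemma Lnorm_cong_AE:
  assumes f: "f \<in> L0 M" and g: "g \<in> L0 M" and eq: "AE x in M. f x = g x"
  shows "Lnorm M s f = Lnorm M s g"
proof -
  note [measurable] = f[unfolded L0_def] g[unfolded L0_def]
  have eq': "AE x in completion M. f x = g x"
    using eq by (rule AE_completion)
  have "(\<integral>\<^sup>+x. ennreal (norm (f x) powr enn2real s) \<partial>completion M) =
        (\<integral>\<^sup>+x. ennreal (norm (g x) powr enn2real s) \<partial>completion M)"
    using eq' by (intro nn_integral_cong_AE) auto
  moreover have "esssup (completion M) (\<lambda>x. ennreal (norm (f x))) =
        esssup (completion M) (\<lambda>x. ennreal (norm (g x)))"
    using eq' by (intro esssup_AE_cong) auto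
  ultimately show ?thesis by (simp add: Lnorm_def)
qed

lemma (in homogeneous_type_space) amalgam_norm_cong_AE:
  assumes f: "f \<in> L0 M" and g: "g \<in> L0 M" and eq: "AE x in M. f x = g x" and r: "0 < r"
  shows "amalgam_norm M d r q p \<alpha> f = amalgam_norm M d r q p \<alpha> g"
proof -
  have "Lnorm M q (\<lambda>x. f x * indicator (qball (space M) d y r) x) =
        Lnorm M q (\<lambda>x. g x * indicator (qball (space M) d y r) x)" if y: "y \<in> space M" for y
  proof (rule Lnorm_cong_AE)
    have "qball (space M) d y r \<in> sets M"
      unfolding sets_eq_borel using openin_qball[OF y r] by (intro sigma_sets.Basic) simp
    then have [measurable]: "qball (space M) d y r \<in> sets (completion M)" by simp
    note [measurable] = f[unfolded L0_def] g[unfolded L0_def]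
    show "(\<lambda>x. f x * indicator (qball (space M) d y r) x) \<in> L0 M"
      and "(\<lambda>x. g x * indicator (qball (space M) d y r) x) \<in> L0 M"
      unfolding L0_def by measurable
  qed (use eq in auto)
  then show ?thesis
    by (simp add: amalgam_norm_def Let_def cong: SUP_cong nn_integral_cong)
qed

end

theory Submission
  imports Defs
begin

text \<open>
  Hoelder's inequality on a ball \<open>B = B(y, r)\<close> gives
  \<open>\<parallel>f \<chi>\<^sub>B\<parallel>\<^sub>q \<le> \<mu>(B)\<^bsup>1/q - 1/\<alpha>\<^esup> \<parallel>f \<chi>\<^sub>B\<parallel>\<^sub>\<alpha>\<close> (\<open>Lnorm_restrict_le\<close>), which cancels all of the
  weight \<open>\<mu>(B)\<^bsup>1/\<alpha> - 1/p - 1/q\<^esup>\<close> except \<open>\<mu>(B)\<^bsup>-1/p\<^esup>\<close>. If \<open>p = \<infinity>\<close>, nothing is left of the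
  weight, and the theorem holds with constant 1.

  If \<open>p < \<infinity>\<close>, one splits \<open>\<parallel>f \<chi>\<^sub>B\<parallel>\<^sub>\<alpha>\<^bsup>p\<^esup> \<le> \<parallel>f\<parallel>\<^sub>\<alpha>\<^bsup>p - \<alpha>\<^esup> \<parallel>f \<chi>\<^sub>B\<parallel>\<^sub>\<alpha>\<^bsup>\<alpha>\<^esup>\<close>, which is where \<open>\<alpha> \<le> p\<close> is
  needed, so that the integrand of the amalgam norm is at most \<open>\<parallel>f\<parallel>\<^sub>\<alpha>\<^bsup>p - \<alpha>\<^esup>\<close> times the average
  of \<open>\<bar>f\<bar>\<^bsup>\<alpha>\<^esup>\<close> over \<open>B(y, r)\<close> (\<open>amalgam_integrand_le\<close>). It remains to see that averaging over balls
  of a fixed radius is bounded on \<open>L\<^sup>1\<close>, uniformly in the radius (\<open>nn_integral_ball_average\<close>).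
  Formally this is Tonelli's theorem: the mass at \<open>x\<close> is spread over those \<open>y\<close> with \<open>d(x, y) < r\<close>,
  with density \<open>1 / \<mu>(B(y, r))\<close>, and by the doubling property this density is comparable to
  \<open>1 / \<mu>(B(x, r))\<close>.

  Tonelli's theorem cannot be applied directly to the indicator of \<open>{(x, y). d(x, y) < r}\<close>. That
  balls are open says only that \<open>d\<close> is upper semicontinuous in each variable separately, and this
  does not make the set measurable for the product \<open>\<sigma>\<close>-algebra, nor \<open>y \<mapsto> \<mu>(B(y, r))\<close> measurable.
  Separability helps: a countable union of products of balls lies between \<open>{d < r}\<close> and \<open>{d < c r}\<close>
  (\<open>measurable_strip\<close>). Since only an upper bound is wanted, this set and the measures of its
  slices can replace the strip and the measures of the balls, at the cost of doubling constants.
\<close>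

section \<open>Balls in a space of homogeneous type\<close>

lemma (in homogeneous_type_space) qball_in_sets [measurable]:
  assumes "x \<in> space M" "0 < r"
  shows "qball (space M) d x r \<in> sets M"
  unfolding sets_eq_borel using openin_qball[OF assms] by (intro sigma_sets.Basic) simp

lemma (in homogeneous_type_space) emeasure_qball:
  assumes "x \<in> space M" "0 < r"
  shows emeasure_qball_pos: "0 < emeasure M (qball (space M) d x r)"
    and emeasure_qball_finite: "emeasure M (qball (space M) d x r) < \<infinity>"
proof -
  obtain C :: real where C: "\<And>x r. x \<in> space M \<Longrightarrow> 0 < r \<Longrightarrow>
      0 < emeasure M (qball (space M) d x (2 * r)) \<and>
      emeasure M (qball (space M) d x (2 * r)) \<le> ennreal C * emeasure M (qball (space M) d x r) \<and>
      ennreal C * emeasure M (qball (space M) d x r) < \<infinity>"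
    using doubling by blast
  show "0 < emeasure M (qball (space M) d x r)"
    using C[of x "r / 2"] assms by simp
  show "emeasure M (qball (space M) d x r) < \<infinity>"
    using C[of x "r / 2"] assms by (auto intro: order.strict_trans1)
qed

text \<open>Iterate the doubling inequality \<open>n\<close> times, where \<open>c < 2\<^sup>n\<close>.\<close>

lemma (in homogeneous_type_space) emeasure_qball_dilate:
  "\<exists>K::real. 0 < K \<and> (\<forall>x\<in>space M. \<forall>r>0.
     emeasure M (qball (space M) d x (c * r)) \<le> ennreal K * emeasure M (qball (space M) d x r))"
proof -
  obtain C0 :: real where C0: "\<And>x r. x \<in> space M \<Longrightarrow> 0 < r \<Longrightarrow>
      emeasure M (qball (space M) d x (2 * r)) \<le> ennreal C0 * emeasure M (qball (space M) d x r)"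
    using doubling by blast
  define C where "C = max 1 C0"
  have "C \<ge> 1" by (simp add: C_def)
  have C: "emeasure M (qball (space M) d x (2 * r)) \<le> ennreal C * emeasure M (qball (space M) d x r)"
    if "x \<in> space M" "0 < r" for x r
    using C0[OF that] by (rule order.trans) (intro mult_right_mono ennreal_leI, auto simp: C_def)
  have iter: "emeasure M (qball (space M) d x (2 ^ n * r))
      \<le> ennreal (C ^ n) * emeasure M (qball (space M) d x r)"
    if "x \<in> space M" "0 < r" for x r n
  proof (induction n)
    case (Suc n)
    have "emeasure M (qball (space M) d x (2 ^ Suc n * r))
        \<le> ennreal C * emeasure M (qball (space M) d x (2 ^ n * r))"
      using C[of x "2 ^ n * r"] that by (simp add: mult.assoc)
    also have "\<dots> \<le> ennreal C * (ennreal (C ^ n) * emeasure M (qball (space M) d x r))"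
      by (intro mult_left_mono Suc) simp
    finally show ?case using \<open>C \<ge> 1\<close> by (simp add: ennreal_mult mult.assoc)
  qed simp
  obtain n where n: "c < 2 ^ n" using real_arch_pow[of 2 c] by auto
  have "emeasure M (qball (space M) d x (c * r)) \<le> ennreal (C ^ n) * emeasure M (qball (space M) d x r)"
    if "x \<in> space M" "0 < r" for x r
  proof -
    have "c * r \<le> 2 ^ n * r" using n that by (intro mult_right_mono) auto
    then have "qball (space M) d x (c * r) \<subseteq> qball (space M) d x (2 ^ n * r)"
      by (auto simp: qball_def)
    then have "emeasure M (qball (space M) d x (c * r)) \<le> emeasure M (qball (space M) d x (2 ^ n * r))"
      using that by (intro emeasure_mono qball_in_sets) auto
    with iter[OF that] show ?thesis by (rule order.trans[rotated])
  qed
  then show ?thesis using \<open>C \<ge> 1\<close> by (intro exI[of _ "C ^ n"]) auto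
qed

text \<open>By the quasi-triangle inequality \<open>B(x, c r) \<subseteq> B(y, 2 \<kappa> c r)\<close>, so that the doubling property,
  stated for concentric balls, also compares balls with different centres.\<close>

lemma (in homogeneous_type_space) emeasure_qball_nearby:
  assumes "1 \<le> c"
  shows "\<exists>K::real. 0 < K \<and> (\<forall>x\<in>space M. \<forall>y\<in>space M. \<forall>r>0. d y x < c * r \<longrightarrow>
     emeasure M (qball (space M) d x (c * r)) \<le> ennreal K * emeasure M (qball (space M) d y r))"
proof -
  obtain \<kappa> where \<kappa>: "1 \<le> \<kappa>" "\<And>x y z. x \<in> space M \<Longrightarrow> y \<in> space M \<Longrightarrow> z \<in> space M \<Longrightarrow>
      d x y \<le> \<kappa> * (d x z + d z y)"
    using quasi_triangle by blast
  obtain K :: real where K: "0 < K" "\<And>x r. x \<in> space M \<Longrightarrow> 0 < r \<Longrightarrow>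
      emeasure M (qball (space M) d x (2 * \<kappa> * c * r)) \<le> ennreal K * emeasure M (qball (space M) d x r)"
    using emeasure_qball_dilate[of "2 * \<kappa> * c"] by blast
  have "emeasure M (qball (space M) d x (c * r)) \<le> ennreal K * emeasure M (qball (space M) d y r)"
    if xy: "x \<in> space M" "y \<in> space M" and r: "0 < r" and "d y x < c * r" for x y r
  proof -
    have "d y z < 2 * \<kappa> * c * r" if z: "z \<in> space M" "d x z < c * r" for z
    proof -
      have "d y z \<le> \<kappa> * (d y x + d x z)" using \<kappa>(2) xy z by blast
      also have "\<dots> < \<kappa> * (c * r + c * r)"
        using \<kappa>(1) z \<open>d y x < c * r\<close> by (intro mult_strict_left_mono add_strict_mono) auto
      finally show ?thesis by (simp add: algebra_simps)
    qed
    then have "qball (space M) d x (c * r) \<subseteq> qball (space M) d y (2 * \<kappa> * c * r)"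
      by (auto simp: qball_def)
    then have "emeasure M (qball (space M) d x (c * r)) \<le> emeasure M (qball (space M) d y (2 * \<kappa> * c * r))"
      using xy r \<kappa>(1) assms by (intro emeasure_mono qball_in_sets) auto
    also have "\<dots> \<le> ennreal K * emeasure M (qball (space M) d y r)" using K(2) xy r by blast
    finally show ?thesis .
  qed
  with K(1) show ?thesis by blast
qed

lemma (in homogeneous_type_space) sigma_finite: "sigma_finite_measure M"
proof -
  have "space M \<noteq> {}" using emeasure_space_infinite by force
  then obtain x where x: "x \<in> space M" by blast
  have "(\<Union>n. qball (space M) d x (real (Suc n))) = space M"
  proof safe
    fix y assume y: "y \<in> space M"
    obtain n where "d x y < real n" using reals_Archimedean2 by blast
    then have "y \<in> qball (space M) d x (real (Suc n))" using y by (auto simp: qball_def)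
    then show "y \<in> (\<Union>n. qball (space M) d x (real (Suc n)))" by blast
  qed (auto simp: qball_def)
  then show ?thesis
    using x emeasure_qball_finite[OF x]
    by (intro sigma_finite_measure.intro
        exI[of _ "range (\<lambda>n. qball (space M) d x (real (Suc n)))"])
       (auto simp: less_top[symmetric] intro: qball_in_sets)
qed

section \<open>Averages over balls of a fixed radius\<close>

text \<open>The set \<open>E = (\<Union>a\<in>D. B(a, r) \<times> B(a, 2 \<kappa> r))\<close>, with \<open>D\<close> countable and dense, does it. If
  \<open>d(x, y) < r\<close>, some \<open>a \<in> D\<close> lies in the open set \<open>B(x, r)\<close>, and then
  \<open>d(a, y) \<le> \<kappa> (d(a, x) + d(x, y)) < 2 \<kappa> r\<close>. Conversely, on \<open>E\<close> the quasi-triangle inequality through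
  \<open>a\<close> gives \<open>d(x, y) < \<kappa> (r + 2 \<kappa> r)\<close>. The constant \<open>c\<close> does not depend on \<open>r\<close>, which keeps the
  estimates below uniform in the radius.\<close>

lemma (in homogeneous_type_space) measurable_strip:
  "\<exists>c\<ge>1. \<forall>r>0. \<exists>E\<in>sets (M \<Otimes>\<^sub>M M). \<forall>x\<in>space M. \<forall>y\<in>space M.
     (d x y < r \<longrightarrow> (x, y) \<in> E) \<and> ((x, y) \<in> E \<longrightarrow> d x y < c * r)"
proof -
  obtain \<kappa> where \<kappa>: "1 \<le> \<kappa>" "\<And>x y z. x \<in> space M \<Longrightarrow> y \<in> space M \<Longrightarrow> z \<in> space M \<Longrightarrow>
      d x y \<le> \<kappa> * (d x z + d z y)"
    using quasi_triangle by blast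
  obtain D where D: "countable D" "D \<subseteq> space M"
      "qtopology (space M) d closure_of D = space M"
    using separable unfolding separable_space_def topspace_qtopology by blast
  define c where "c = \<kappa> * (1 + 2 * \<kappa>)"
  have "1 * 1 \<le> c" unfolding c_def using \<kappa>(1) by (intro mult_mono) auto
  moreover have "\<exists>E\<in>sets (M \<Otimes>\<^sub>M M). \<forall>x\<in>space M. \<forall>y\<in>space M.
     (d x y < r \<longrightarrow> (x, y) \<in> E) \<and> ((x, y) \<in> E \<longrightarrow> d x y < c * r)" if r: "0 < r" for r
  proof (intro bexI ballI conjI impI)
    let ?E = "\<Union>a\<in>D. qball (space M) d a r \<times> qball (space M) d a (2 * \<kappa> * r)"
    show "?E \<in> sets (M \<Otimes>\<^sub>M M)"
      using D(1,2) r \<kappa>(1)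
      by (intro sets.countable_UN'' pair_measureI qball_in_sets) auto
    fix x y assume xy: "x \<in> space M" "y \<in> space M"
    show "(x, y) \<in> ?E" if "d x y < r"
    proof -
      have "x \<in> qball (space M) d x r" using xy r eq_0_iff[of x x] by (simp add: qball_def)
      then obtain a where a: "a \<in> D" "a \<in> qball (space M) d x r"
        using D(3) xy openin_qball[OF xy(1) r] in_closure_of[of x "qtopology (space M) d" D]
        by blast
      then have aM: "a \<in> space M" and "d x a < r" by (auto simp: qball_def)
      then have ax: "d a x < r" using sym xy by simp
      have "d a y \<le> \<kappa> * (d a x + d x y)" using \<kappa>(2) aM xy by blast
      also have "\<dots> < \<kappa> * (r + r)"
        using \<kappa>(1) ax that by (intro mult_strict_left_mono add_strict_mono) auto
      finally have "d a y < 2 * \<kappa> * r" by (simp add: algebra_simps)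
      then show ?thesis using a(1) ax xy by (auto simp: qball_def)
    qed
    show "d x y < c * r" if "(x, y) \<in> ?E"
    proof -
      from that obtain a where a: "a \<in> D" "d a x < r" "d a y < 2 * \<kappa> * r"
        by (auto simp: qball_def)
      then have aM: "a \<in> space M" using D(2) by blast
      then have "d x a < r" using sym xy a by simp
      have "d x y \<le> \<kappa> * (d x a + d a y)" using \<kappa>(2) aM xy by blast
      also have "\<dots> < \<kappa> * (r + 2 * \<kappa> * r)"
        using \<kappa>(1) \<open>d x a < r\<close> a by (intro mult_strict_left_mono add_strict_mono) auto
      finally show ?thesis by (simp add: c_def algebra_simps)
    qed
  qed
  ultimately show ?thesis by (intro exI[of _ c]) auto
qed

text \<open>Let \<open>E\<close> be the thickened strip and \<open>v y\<close> the measure of its slice at \<open>y\<close>. The slice lies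
  between \<open>B(y, r)\<close> and \<open>B(y, c r)\<close>, whence \<open>\<mu>(B(y, r)) \<le> v y \<le> K \<mu>(B(y, r))\<close>. Replacing the ball
  by the slice and \<open>1 / \<mu>(B(y, r))\<close> by \<open>K / v y\<close> only increases the left-hand side and makes the
  integrand jointly measurable, so Tonelli's theorem applies. For fixed \<open>x\<close> the integral over \<open>y\<close>
  then runs over a subset of \<open>B(x, c r)\<close>, where \<open>1 / v y \<le> K / \<mu>(B(x, c r))\<close>; it is at most \<open>K\<close>.

  The outer integrand on the left need not be measurable: its \<open>nn_integral\<close> is then a lower
  integral, which is still monotone.\<close>

lemma (in homogeneous_type_space) nn_integral_ball_average:
  "\<exists>K::real. 0 < K \<and> (\<forall>r>0. \<forall>h\<in>borel_measurable (completion M).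
     (\<integral>\<^sup>+y. (\<integral>\<^sup>+x. h x * indicator (qball (space M) d y r) x \<partial>M) / emeasure M (qball (space M) d y r) \<partial>M)
       \<le> ennreal K * (\<integral>\<^sup>+x. h x \<partial>M))"
proof -
  obtain c where c: "1 \<le> c" and strip: "\<And>r. r > 0 \<Longrightarrow> \<exists>E\<in>sets (M \<Otimes>\<^sub>M M). \<forall>x\<in>space M. \<forall>y\<in>space M.
     (d x y < r \<longrightarrow> (x, y) \<in> E) \<and> ((x, y) \<in> E \<longrightarrow> d x y < c * r)"
    using measurable_strip by blast
  obtain K :: real where K: "0 < K" "\<And>x y r. x \<in> space M \<Longrightarrow> y \<in> space M \<Longrightarrow> 0 < r \<Longrightarrow> d y x < c * r \<Longrightarrow>
     emeasure M (qball (space M) d x (c * r)) \<le> ennreal K * emeasure M (qball (space M) d y r)"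
    using emeasure_qball_nearby[OF c] by blast
  interpret pair_sigma_finite M M
    using sigma_finite by (simp add: pair_sigma_finite_def)
  have "(\<integral>\<^sup>+y. (\<integral>\<^sup>+x. h x * indicator (qball (space M) d y r) x \<partial>M) / emeasure M (qball (space M) d y r) \<partial>M)
       \<le> ennreal (K * K) * (\<integral>\<^sup>+x. h x \<partial>M)" (is "?lhs \<le> _")
    if r: "0 < r" and h: "h \<in> borel_measurable (completion M)" for r and h :: "'a \<Rightarrow> ennreal"
  proof -
    obtain g where g [measurable]: "g \<in> borel_measurable M" and gh: "AE x in M. h x = g x"
      using completion_ex_borel_measurable[OF h] by blast
    obtain E where E [measurable]: "E \<in> sets (M \<Otimes>\<^sub>M M)"
      and E1: "\<And>x y. x \<in> space M \<Longrightarrow> y \<in> space M \<Longrightarrow> d x y < r \<Longrightarrow> (x, y) \<in> E"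
      and E2: "\<And>x y. x \<in> space M \<Longrightarrow> y \<in> space M \<Longrightarrow> (x, y) \<in> E \<Longrightarrow> d x y < c * r"
      using strip[OF r] by blast
    have cr: "0 < c * r" using c r by simp
    let ?B = "\<lambda>y. qball (space M) d y r" and ?B' = "\<lambda>y. qball (space M) d y (c * r)"
    define v where "v y = emeasure M (Pair y -` E)" for y
    have v_meas [measurable]: "v \<in> borel_measurable M"
      unfolding v_def by (rule measurable_emeasure_Pair1[OF E])
    have E_space: "E \<subseteq> space M \<times> space M"
      using sets.sets_into_space[OF E] by (simp add: space_pair_measure)
    have slice [measurable]: "Pair y -` E \<in> sets M" for y by (rule sets_Pair1[OF E])
    have v_ge: "emeasure M (?B y) \<le> v y" if "y \<in> space M" for y
      unfolding v_def using that E1 by (intro emeasure_mono slice) (auto simp: qball_def)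
    have v_le: "v y \<le> ennreal K * emeasure M (?B y)" if y: "y \<in> space M" for y
    proof -
      have "v y \<le> emeasure M (?B' y)"
        unfolding v_def using y E2 E_space cr by (intro emeasure_mono qball_in_sets) (auto simp: qball_def)
      also have "\<dots> \<le> ennreal K * emeasure M (?B y)"
        using K(2)[of y y r] y r eq_0_iff[of y y] cr by simp
      finally show ?thesis .
    qed
    have v_pos: "0 < v y" if "y \<in> space M" for y
      using v_ge[OF that] emeasure_qball_pos[OF that r] by simp
    have v_fin: "v y < top" if "y \<in> space M" for y
      using emeasure_qball_finite[OF that r]
      by (intro order.strict_trans1[OF v_le[OF that]]) (simp add: ennreal_mult_less_top)
    have "?lhs \<le> (\<integral>\<^sup>+y. (\<integral>\<^sup>+x. ennreal K * (g x * indicator E (y, x)) / v y \<partial>M) \<partial>M)"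
    proof (rule nn_integral_mono)
      fix y assume y: "y \<in> space M"
      let ?J = "\<integral>\<^sup>+x. g x * indicator E (y, x) \<partial>M"
      have "(\<integral>\<^sup>+x. h x * indicator (?B y) x \<partial>M) = (\<integral>\<^sup>+x. g x * indicator (?B y) x \<partial>M)"
        using gh by (intro nn_integral_cong_AE) auto
      also have "\<dots> \<le> ?J"
        using E1[OF y] by (intro nn_integral_mono mult_left_mono) (auto simp: qball_def split: split_indicator)
      finally have "(\<integral>\<^sup>+x. h x * indicator (?B y) x \<partial>M) / emeasure M (?B y) \<le> ?J / emeasure M (?B y)"
        by (rule divide_right_mono_ennreal)
      also have "\<dots> \<le> ennreal K * ?J / v y"
      proof (rule divide_le_posI_ennreal)
        have "?J = v y * ?J / v y"
          using v_pos[OF y] v_fin[OF y] ennreal_mult_divide_eq[of "v y" ?J] by (simp add: mult.commute)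
        also have "\<dots> \<le> (ennreal K * emeasure M (?B y)) * ?J / v y"
          by (intro divide_right_mono_ennreal mult_right_mono v_le y) simp
        finally show "?J \<le> emeasure M (?B y) * (ennreal K * ?J / v y)"
          by (simp add: ennreal_times_divide mult_ac)
      qed (rule emeasure_qball_pos[OF y r])
      also have "\<dots> = (\<integral>\<^sup>+x. ennreal K * (g x * indicator E (y, x)) / v y \<partial>M)"
        using y by (simp add: nn_integral_cmult nn_integral_divide)
      finally show "(\<integral>\<^sup>+x. h x * indicator (?B y) x \<partial>M) / emeasure M (?B y) \<le> \<dots>" .
    qed
    also have "\<dots> = (\<integral>\<^sup>+x. (\<integral>\<^sup>+y. ennreal K * (g x * indicator E (y, x)) / v y \<partial>M) \<partial>M)"
      by (rule Fubini'[symmetric]) measurable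
    also have "\<dots> \<le> (\<integral>\<^sup>+x. ennreal (K * K) * g x \<partial>M)"
    proof (rule nn_integral_mono)
      fix x assume x: "x \<in> space M"
      let ?m = "emeasure M (?B' x)"
      have m: "0 < ?m" "?m < top" using emeasure_qball_pos[OF x cr] emeasure_qball_finite[OF x cr] by auto
      have "ennreal K * (g x * indicator E (y, x)) / v y
          \<le> (ennreal K * ennreal K * g x / ?m) * indicator (?B' x) y" if y: "y \<in> space M" for y
      proof (cases "(y, x) \<in> E")
        case True
        then have "d y x < c * r" using E2 x y by blast
        then have "?m \<le> ennreal K * emeasure M (?B y)" and yB: "y \<in> ?B' x"
          using K(2) x y r sym by (auto simp: qball_def)
        then have *: "?m \<le> ennreal K * v y"
          by (meson mult_left_mono order_trans v_ge y zero_le)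
        have "ennreal K * g x / v y \<le> ennreal K * ennreal K * g x / ?m"
        proof (rule divide_le_posI_ennreal[OF v_pos[OF y]])
          have "ennreal K * g x = ennreal K * g x * ?m / ?m"
            using m by (simp add: ennreal_mult_divide_eq)
          also have "\<dots> \<le> ennreal K * g x * (ennreal K * v y) / ?m"
            by (intro divide_right_mono_ennreal mult_left_mono *) simp
          finally show "ennreal K * g x \<le> v y * (ennreal K * ennreal K * g x / ?m)"
            by (simp add: ennreal_times_divide mult_ac)
        qed
        with True yB show ?thesis by simp
      qed simp
      then have "(\<integral>\<^sup>+y. ennreal K * (g x * indicator E (y, x)) / v y \<partial>M)
          \<le> (\<integral>\<^sup>+y. (ennreal K * ennreal K * g x / ?m) * indicator (?B' x) y \<partial>M)"
        by (intro nn_integral_mono)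
      also have "\<dots> = (ennreal K * ennreal K * g x / ?m) * ?m"
        using qball_in_sets[OF x cr] by (simp add: nn_integral_cmult_indicator)
      also have "\<dots> = ennreal (K * K) * g x"
        using m K(1) by (simp add: ennreal_divide_times ennreal_mult)
      finally show "(\<integral>\<^sup>+y. ennreal K * (g x * indicator E (y, x)) / v y \<partial>M) \<le> ennreal (K * K) * g x" .
    qed
    also have "\<dots> = ennreal (K * K) * (\<integral>\<^sup>+x. g x \<partial>M)"
      by (rule nn_integral_cmult) measurable
    also have "(\<integral>\<^sup>+x. g x \<partial>M) = (\<integral>\<^sup>+x. h x \<partial>M)"
      using gh by (intro nn_integral_cong_AE) (auto elim: eventually_mono)
    finally show ?thesis .
  qed
  with K(1) show ?thesis by (intro exI[of _ "K * K"]) auto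
qed

section \<open>Norms of restrictions\<close>

lemma ennpowr_mono: "x \<le> y \<Longrightarrow> 0 \<le> a \<Longrightarrow> ennpowr x a \<le> ennpowr y a"
  by (auto simp: ennpowr_def top_unique less_top intro!: ennreal_leI powr_mono2 enn2real_mono)

lemma ennpowr_ennreal: "0 \<le> t \<Longrightarrow> ennpowr (ennreal t) a = ennreal (t powr a)"
  by (simp add: ennpowr_def)

lemma recip_top [simp]: "recip top = 0"
  by (simp add: recip_def)

lemma recip_ennreal: "0 < s \<Longrightarrow> recip (ennreal s) = 1 / s"
  by (simp add: recip_def divide_ennreal flip: ennreal_1)

lemma Lnorm_ennreal:
  "0 < s \<Longrightarrow> Lnorm M (ennreal s) f = ennpowr (\<integral>\<^sup>+x. ennreal (norm (f x) powr s) \<partial>M) (1 / s)"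
  by (simp add: Lnorm_def recip_ennreal nn_integral_completion)

lemma Lnorm_infinity: "Lnorm M \<infinity> f = esssup (completion M) (\<lambda>x. ennreal (norm (f x)))"
  by (simp add: Lnorm_def)

lemma L0_restrict: "f \<in> L0 M \<Longrightarrow> B \<in> sets M \<Longrightarrow> (\<lambda>x. f x * indicator B x) \<in> L0 M"
  unfolding L0_def by (intro borel_measurable_times borel_measurable_indicator) auto

lemma Lnorm_restrict_mono:
  assumes f: "f \<in> L0 M" and B: "B \<in> sets M" and s: "0 < s"
  shows "Lnorm M s (\<lambda>x. f x * indicator B x) \<le> Lnorm M s f"
proof (cases s)
  case top
  show ?thesis
    using L0_restrict[OF f B] unfolding top infinity_ennreal_def[symmetric] Lnorm_infinity L0_def
    by (intro esssup_mono) (auto split: split_indicator)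
next
  case (real t)
  then show ?thesis
    using s by (auto simp: Lnorm_ennreal norm_mult intro!: ennpowr_mono nn_integral_mono split: split_indicator)
qed

section \<open>Hoelder's inequality on a set of finite measure\<close>

text \<open>The function \<open>t \<mapsto> t\<^bsup>q\<^esup>\<close> is concave in \<open>t\<^bsup>a\<^esup>\<close> and hence lies below its tangent at \<open>t = l\<close>; the
  right-hand side is that tangent. This is the weighted inequality of Young for \<open>(t / l)\<^bsup>a\<^esup>\<close> and 1.\<close>

lemma powr_le_Young:
  fixes t l :: real
  assumes "0 < q" "q \<le> a" "0 \<le> t" "0 < l"
  shows "t powr q \<le> (q / a * l powr (q - a)) * t powr a + (1 - q / a) * l powr q"
proof (cases "t = 0")
  case True
  with assms show ?thesis by simp
next
  case False
  with assms have t: "0 < t" by simp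
  have "((t / l) powr a) powr (q / a) * 1 powr (1 - q / a) \<le> q / a * (t / l) powr a + (1 - q / a) * 1"
    using assms t by (intro Youngs_inequality_0) auto
  then have "(t / l) powr q \<le> q / a * (t / l) powr a + (1 - q / a)"
    using assms by (simp add: powr_powr)
  then have "l powr q * (t / l) powr q \<le> l powr q * (q / a * (t / l) powr a + (1 - q / a))"
    by (rule mult_left_mono) simp
  also have "\<dots> = (q / a * l powr (q - a)) * t powr a + (1 - q / a) * l powr q"
    using assms t by (simp add: powr_divide powr_diff algebra_simps)
  also have "l powr q * (t / l) powr q = t powr q"
    using assms t by (simp add: powr_divide)
  finally show ?thesis .
qed

text \<open>Hoelder's (here also Jensen's) inequality, obtained by integrating the tangent inequality
  \<open>powr_le_Young\<close>. The best point of tangency is the power mean \<open>l = (A / m)\<^bsup>1/a\<^esup>\<close> of \<open>u\<close>; there the two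
  terms of the integrated tangent add up to \<open>m l\<^bsup>q\<^esup>\<close>.\<close>

lemma nn_integral_powr_le_powr:
  fixes u :: "'a \<Rightarrow> real"
  assumes u: "u \<in> borel_measurable M" "\<And>x. 0 \<le> u x" and B: "B \<in> sets M"
    and m: "emeasure M B = ennreal m" "0 < m" and q: "0 < q" "q \<le> a"
    and A: "(\<integral>\<^sup>+x. ennreal (u x powr a) * indicator B x \<partial>M) = ennreal A" "0 \<le> A"
  shows "(\<integral>\<^sup>+x. ennreal (u x powr q) * indicator B x \<partial>M) \<le> ennreal (m * (A / m) powr (q / a))"
proof (cases "A = 0")
  case True
  \<comment> \<open>Here the mean is 0, which is not an admissible point of tangency.\<close>
  note [measurable] = u(1) B
  have "AE x in M. ennreal (u x powr a) * indicator B x = 0"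
    using A True by (subst nn_integral_0_iff_AE[symmetric]) auto
  then have "AE x in M. ennreal (u x powr q) * indicator B x = 0"
    by eventually_elim (auto split: split_indicator)
  then have "(\<integral>\<^sup>+x. ennreal (u x powr q) * indicator B x \<partial>M) = 0"
    by (subst nn_integral_0_iff_AE) auto
  then show ?thesis by simp
next
  case False
  note [measurable] = u(1) B
  define l where "l = (A / m) powr (1 / a)"
  have l: "0 < l" using False A m by (simp add: l_def)
  have la: "l powr a = A / m" using False A m q by (simp add: l_def powr_powr)
  have lq: "l powr q = (A / m) powr (q / a)" by (simp add: l_def powr_powr)
  define c where "c = q / a * l powr (q - a)"
  define e where "e = (1 - q / a) * l powr q"
  have ce: "0 \<le> c" "0 \<le> e" using q by (auto simp: c_def e_def)
  have *: "ennreal (u x powr q) \<le> ennreal c * ennreal (u x powr a) + ennreal e" for x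
  proof -
    have "ennreal (u x powr q) \<le> ennreal (c * u x powr a + e)"
      unfolding c_def e_def by (intro ennreal_leI powr_le_Young q u l)
    then show ?thesis using ce by (simp add: ennreal_mult)
  qed
  have "(\<integral>\<^sup>+x. ennreal (u x powr q) * indicator B x \<partial>M)
      \<le> (\<integral>\<^sup>+x. ennreal c * (ennreal (u x powr a) * indicator B x) + ennreal e * indicator B x \<partial>M)"
    using * by (intro nn_integral_mono) (simp split: split_indicator)
  also have "\<dots> = ennreal c * ennreal A + ennreal e * ennreal m"
    by (simp add: nn_integral_add nn_integral_cmult nn_integral_cmult_indicator A m)
  also have "\<dots> = ennreal (c * A + e * m)"
    using ce A m by (simp add: ennreal_mult)
  also have "c * A + e * m = m * l powr q"
  proof -
    have "c * A = q / a * l powr q * (A / l powr a)" by (simp add: c_def powr_diff)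
    also have "A / l powr a = m" using la False A m by simp
    finally show ?thesis by (simp add: e_def algebra_simps)
  qed
  finally show ?thesis by (simp add: lq)
qed

text \<open>Hoelder's inequality in the norms, for all exponents up to \<open>\<infinity>\<close>. For \<open>q < \<alpha> = \<infinity>\<close> one bounds
  \<open>\<bar>f\<bar>\<close> on \<open>B\<close> by its essential supremum; for \<open>\<alpha> < \<infinity>\<close> it is \<open>nn_integral_powr_le_powr\<close>. A right-hand
  norm equal to \<open>\<infinity>\<close> makes the claim trivial, because its coefficient is positive.\<close>

lemma Lnorm_restrict_le:
  assumes f: "f \<in> L0 M" and B: "B \<in> sets M" and m: "0 < emeasure M B" "emeasure M B < \<infinity>"
    and q: "1 \<le> q" "q \<le> \<alpha>"
  shows "Lnorm M q (\<lambda>x. f x * indicator B x)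
    \<le> ennreal (measure M B powr (recip q - recip \<alpha>)) * Lnorm M \<alpha> (\<lambda>x. f x * indicator B x)"
proof -
  let ?f = "\<lambda>x. f x * indicator B x" and ?m = "measure M B"
  have [measurable]: "?f \<in> borel_measurable (completion M)"
    using L0_restrict[OF f B] by (simp add: L0_def)
  note [measurable] = B
  have em: "emeasure M B = ennreal ?m"
    using m by (simp add: emeasure_eq_ennreal_measure)
  then have m_pos: "0 < ?m" using m by (simp add: zero_less_measure_iff)
  consider "q = \<infinity>" "\<alpha> = \<infinity>" | q' where "q = ennreal q'" "1 \<le> q'" "\<alpha> = \<infinity>"
    | q' a where "q = ennreal q'" "1 \<le> q'" "\<alpha> = ennreal a" "q' \<le> a"
    using q by (cases q; cases \<alpha>) (auto simp: top_unique)
  then show ?thesis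
  proof cases
    case 1
    then show ?thesis using m_pos by simp
  next
    case 2
    show ?thesis
    proof (cases "Lnorm M \<alpha> ?f")
      case (real S)
      have "AE x in completion M. ennreal (norm (?f x)) \<le> ennreal S"
        using esssup_AE[of "\<lambda>x. ennreal (norm (?f x))" "completion M"] 2(3) real(2)
        unfolding Lnorm_infinity[symmetric] by simp
      then have "AE x in M. ennreal (norm (?f x)) \<le> ennreal S" by (simp add: AE_completion_iff)
      then have "(\<integral>\<^sup>+x. ennreal (norm (?f x) powr q') \<partial>M) \<le> (\<integral>\<^sup>+x. ennreal (S powr q') * indicator B x \<partial>M)"
        using 2 real by (intro nn_integral_mono_AE, elim eventually_mono)
          (auto split: split_indicator intro!: ennreal_leI powr_mono2)
      also have "\<dots> = ennreal (S powr q' * ?m)"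
        by (simp add: nn_integral_cmult_indicator em ennreal_mult)
      finally have "Lnorm M q ?f \<le> ennpowr (ennreal (S powr q' * ?m)) (1 / q')"
        using 2 by (simp add: Lnorm_ennreal ennpowr_mono)
      also have "\<dots> = ennreal (?m powr (1 / q') * S)"
        using 2 real by (simp add: ennpowr_ennreal powr_mult powr_powr mult.commute)
      finally show ?thesis using 2 real by (simp add: recip_ennreal ennreal_mult)
    qed (use m_pos in \<open>simp add: ennreal_mult_top\<close>)
  next
    case 3
    show ?thesis
    proof (cases "\<integral>\<^sup>+x. ennreal (norm (?f x) powr a) \<partial>completion M")
      case (real A)
      have ind: "norm (?f x) powr s = norm (?f x) powr s * indicator B x" if "0 < s" for s x
        using that by (simp split: split_indicator)
      have "(\<integral>\<^sup>+x. ennreal (norm (?f x) powr q') * indicator B x \<partial>completion M)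
          \<le> ennreal (?m * (A / ?m) powr (q' / a))"
        using 3 real m_pos em
        by (intro nn_integral_powr_le_powr)
           (auto intro!: nn_integral_cong split: split_indicator simp flip: real(2))
      also have "(\<integral>\<^sup>+x. ennreal (norm (?f x) powr q') * indicator B x \<partial>completion M)
          = (\<integral>\<^sup>+x. ennreal (norm (?f x) powr q') \<partial>M)"
        unfolding nn_integral_completion using 3 by (intro nn_integral_cong) (simp split: split_indicator)
      finally have "Lnorm M q ?f \<le> ennpowr (ennreal (?m * (A / ?m) powr (q' / a))) (1 / q')"
        using 3 by (simp add: Lnorm_ennreal ennpowr_mono)
      also have "\<dots> = ennreal (?m powr (1 / q' - 1 / a) * A powr (1 / a))"
        using 3 real m_pos
        by (simp add: ennpowr_ennreal powr_mult powr_powr powr_divide powr_diff)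
      also have "\<dots> = ennreal (?m powr (recip q - recip \<alpha>)) * Lnorm M \<alpha> ?f"
        using 3 real by (simp add: Lnorm_ennreal recip_ennreal nn_integral_completion ennpowr_ennreal ennreal_mult)
      finally show ?thesis .
    next
      case top
      then show ?thesis
        using 3 m_pos by (simp add: Lnorm_ennreal nn_integral_completion ennpowr_def ennreal_mult_top)
    qed
  qed
qed

section \<open>Comparison of the amalgam norm with the Lebesgue norm\<close>

text \<open>The number \<open>\<delta>\<close> stands for \<open>1 / p\<close>. Hoelder's inequality uses up the rest of the weight.\<close>

lemma (in homogeneous_type_space) Lnorm_qball_le:
  assumes f: "f \<in> L0 M" and y: "y \<in> space M" and r: "0 < r" and q: "1 \<le> q" "q \<le> \<alpha>"
  defines "B \<equiv> qball (space M) d y r"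
  shows "ennreal (measure M B powr (recip \<alpha> - \<delta> - recip q)) * Lnorm M q (\<lambda>x. f x * indicator B x)
    \<le> ennreal (measure M B powr (- \<delta>)) * Lnorm M \<alpha> (\<lambda>x. f x * indicator B x)"
proof -
  have B: "B \<in> sets M" "0 < emeasure M B" "emeasure M B < \<infinity>"
    unfolding B_def using qball_in_sets[OF y r] emeasure_qball[OF y r] by auto
  let ?g = "\<lambda>x. f x * indicator B x" and ?m = "measure M B"
  have "ennreal (?m powr (recip \<alpha> - \<delta> - recip q)) * Lnorm M q ?g
      \<le> ennreal (?m powr (recip \<alpha> - \<delta> - recip q)) *
        (ennreal (?m powr (recip q - recip \<alpha>)) * Lnorm M \<alpha> ?g)"
    by (intro mult_left_mono Lnorm_restrict_le f B q) simp
  also have "\<dots> = ennreal (?m powr (- \<delta>)) * Lnorm M \<alpha> ?g"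
    by (simp add: mult.assoc[symmetric] ennreal_mult[symmetric] powr_add[symmetric])
  finally show ?thesis .
qed

text \<open>With \<open>A = \<integral>\<^sub>B \<bar>f\<bar>\<^bsup>a\<^esup>\<close>, the previous lemma bounds the left-hand side by \<open>A\<^bsup>s/a\<^esup> / \<mu>(B)\<close>. Since
  \<open>A \<le> I\<close> and \<open>s / a - 1 \<ge> 0\<close>, all but one of the powers of \<open>A\<close> can be estimated by the global
  quantity \<open>I\<close>, and what remains is linear in \<open>\<bar>f\<bar>\<^bsup>a\<^esup>\<close>. The factor \<open>I\<^bsup>s/a - 1\<^esup>\<close> is kept under the
  integral sign, so that the bound is the average of a single function: the average need not be
  measurable in \<open>y\<close>, and then a constant cannot simply be taken out of its integral over \<open>y\<close>.\<close>

lemma (in homogeneous_type_space) amalgam_integrand_le: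
  fixes a s :: real
  assumes f: "f \<in> L0 M" and y: "y \<in> space M" and r: "0 < r"
    and q: "1 \<le> q" "q \<le> ennreal a" and s: "a \<le> s"
    and I: "(\<integral>\<^sup>+x. ennreal (norm (f x) powr a) \<partial>M) = ennreal I" "0 \<le> I"
  defines "B \<equiv> qball (space M) d y r"
  shows "ennpowr (ennreal (measure M B powr (recip (ennreal a) - recip (ennreal s) - recip q)) *
        Lnorm M q (\<lambda>x. f x * indicator B x)) s
    \<le> (\<integral>\<^sup>+x. ennreal (I powr (s / a - 1)) * ennreal (norm (f x) powr a) * indicator B x \<partial>M)
      / emeasure M B"
proof -
  have "1 \<le> ennreal a" using q by (rule order.trans)
  then have a: "1 \<le> a" by simp
  let ?m = "measure M B" and ?J = "\<integral>\<^sup>+x. ennreal (norm (f x) powr a) * indicator B x \<partial>M"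
  have B: "0 < emeasure M B" "emeasure M B < \<infinity>"
    unfolding B_def using emeasure_qball[OF y r] by auto
  then have em: "emeasure M B = ennreal ?m"
    by (simp add: emeasure_eq_ennreal_measure)
  then have m: "0 < ?m" using B by (simp add: zero_less_measure_iff)
  have "?J \<le> ennreal I"
    unfolding I(1)[symmetric] by (intro nn_integral_mono) (simp split: split_indicator)
  then obtain A where A: "?J = ennreal A" "0 \<le> A" "A \<le> I"
    using I(2) by (cases ?J) (auto simp: top_unique)
  have "Lnorm M (ennreal a) (\<lambda>x. f x * indicator B x) = ennpowr ?J (1 / a)"
    using a by (subst Lnorm_ennreal)
      (auto intro!: arg_cong2[where f = ennpowr] nn_integral_cong split: split_indicator)
  also have "\<dots> = ennreal (A powr (1 / a))"
    using A by (simp add: ennpowr_ennreal)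
  finally have "ennreal (?m powr (recip (ennreal a) - recip (ennreal s) - recip q)) *
      Lnorm M q (\<lambda>x. f x * indicator B x) \<le> ennreal (?m powr (- recip (ennreal s)) * A powr (1 / a))"
    using Lnorm_qball_le[OF f y r q, folded B_def] by (simp add: ennreal_mult)
  then have "ennpowr (ennreal (?m powr (recip (ennreal a) - recip (ennreal s) - recip q)) *
      Lnorm M q (\<lambda>x. f x * indicator B x)) s \<le> ennpowr (ennreal (?m powr (- recip (ennreal s)) * A powr (1 / a))) s"
    using a s by (intro ennpowr_mono) auto
  also have "\<dots> = ennreal (A powr (s / a) / ?m)"
    using a s m A by (simp add: ennpowr_ennreal recip_ennreal powr_mult powr_divide powr_powr powr_minus_divide)
  also have "\<dots> \<le> ennreal (I powr (s / a - 1) * (A / ?m))"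
  proof -
    have "A powr (s / a) = A powr (s / a - 1) * A"
      using A(2) by (cases "A = 0") (auto simp: powr_diff)
    also have "\<dots> \<le> I powr (s / a - 1) * A"
      using A a s by (intro mult_right_mono powr_mono2) auto
    finally show ?thesis using m by (intro ennreal_leI) (simp add: divide_right_mono)
  qed
  also have "\<dots> = ennreal (I powr (s / a - 1)) * (?J / emeasure M B)"
    unfolding A(1) em using A(2) m by (simp add: divide_ennreal ennreal_mult[symmetric])
  also have "\<dots> = (\<integral>\<^sup>+x. ennreal (I powr (s / a - 1)) * ennreal (norm (f x) powr a) * indicator B x \<partial>M)
      / emeasure M B"
  proof -
    have [measurable]: "f \<in> borel_measurable (completion M)" "B \<in> sets (completion M)"
      using f qball_in_sets[OF y r] by (auto simp: L0_def B_def)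
    have "ennreal (I powr (s / a - 1)) * (\<integral>\<^sup>+x. ennreal (norm (f x) powr a) * indicator B x \<partial>completion M)
        = (\<integral>\<^sup>+x. ennreal (I powr (s / a - 1)) * (ennreal (norm (f x) powr a) * indicator B x) \<partial>completion M)"
      by (rule nn_integral_cmult[symmetric]) measurable
    then show ?thesis by (simp add: ennreal_times_divide nn_integral_completion mult.assoc)
  qed
  finally show ?thesis .
qed

theorem theorem2p6:
  fixes M :: "'a measure" and d :: "'a \<Rightarrow> 'a \<Rightarrow> real" and q \<alpha> p :: ennreal
  assumes "homogeneous_type_space M d"
    and "1 \<le> q" and "q \<le> \<alpha>" and "\<alpha> \<le> p"
  shows "\<exists>C::real. C > 0 \<and>
    (\<forall>f\<in>L0 M. \<forall>r>0. amalgam_norm M d r q p \<alpha> f \<le> ennreal C * Lnorm M \<alpha> f)"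
proof -
  interpret homogeneous_type_space M d by fact
  have "1 \<le> \<alpha>" using assms by (auto intro: order.trans)
  then have \<alpha>_pos: "0 < \<alpha>" by (rule order.strict_trans2[OF zero_less_one])
  show ?thesis
  proof (cases p)
    case top
    have "amalgam_norm M d r q p \<alpha> f \<le> Lnorm M \<alpha> f" if f: "f \<in> L0 M" and r: "0 < r" for f r
    proof -
      have "ennreal (measure M (qball (space M) d y r) powr (recip \<alpha> - recip q)) *
          Lnorm M q (\<lambda>x. f x * indicator (qball (space M) d y r) x) \<le> Lnorm M \<alpha> f"
        if y: "y \<in> space M" for y
      proof -
        have "0 < measure M (qball (space M) d y r)"
          using emeasure_qball_pos[OF y r] emeasure_qball_finite[OF y r]
          by (simp add: measure_def enn2real_positive_iff)
        then show ?thesis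
          using Lnorm_qball_le[OF f y r assms(2,3), of 0]
            Lnorm_restrict_mono[OF f qball_in_sets[OF y r] \<alpha>_pos]
          by simp
      qed
      then show ?thesis
        unfolding amalgam_norm_def Let_def by (simp add: top SUP_le_iff)
    qed
    then show ?thesis by (intro exI[of _ 1]) simp
  next
    case (real s)
    with \<open>\<alpha> \<le> p\<close> obtain a where a: "\<alpha> = ennreal a" "0 \<le> a"
      by (cases \<alpha>) (auto simp: top_unique)
    have a1: "1 \<le> a" using \<open>1 \<le> \<alpha>\<close> a by simp
    have as: "a \<le> s" using \<open>\<alpha> \<le> p\<close> a real by simp
    obtain K :: real where K: "0 < K"
      "\<And>r h. 0 < r \<Longrightarrow> h \<in> borel_measurable (completion M) \<Longrightarrow>
        (\<integral>\<^sup>+y. (\<integral>\<^sup>+x. h x * indicator (qball (space M) d y r) x \<partial>M) / emeasure M (qball (space M) d y r) \<partial>M)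
          \<le> ennreal K * (\<integral>\<^sup>+x. h x \<partial>M)"
      using nn_integral_ball_average by blast
    have "amalgam_norm M d r q p \<alpha> f \<le> ennreal (K powr (1 / s)) * Lnorm M \<alpha> f"
      if f: "f \<in> L0 M" and r: "0 < r" for f r
    proof (cases "\<integral>\<^sup>+x. ennreal (norm (f x) powr a) \<partial>M")
      case (real I)
      let ?B = "\<lambda>y. qball (space M) d y r"
      let ?h = "\<lambda>x. ennreal (I powr (s / a - 1)) * ennreal (norm (f x) powr a)"
      have f' [measurable]: "f \<in> borel_measurable (completion M)"
        using f by (simp add: L0_def)
      have h: "?h \<in> borel_measurable (completion M)" by measurable
      have "(\<integral>\<^sup>+y. ennpowr (ennreal (measure M (?B y) powr (recip \<alpha> - recip p - recip q)) *
          Lnorm M q (\<lambda>x. f x * indicator (?B y) x)) s \<partial>M)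
        \<le> (\<integral>\<^sup>+y. (\<integral>\<^sup>+x. ?h x * indicator (?B y) x \<partial>M) / emeasure M (?B y) \<partial>M)"
        using assms(2,3) unfolding a(1) \<open>p = ennreal s\<close>
        by (intro nn_integral_mono amalgam_integrand_le f r as real)
      also have "\<dots> \<le> ennreal K * (\<integral>\<^sup>+x. ?h x \<partial>completion M)"
        using K(2)[OF r h] by (simp add: nn_integral_completion)
      also have "(\<integral>\<^sup>+x. ?h x \<partial>completion M) = ennreal (I powr (s / a - 1)) * ennreal I"
        by (subst nn_integral_cmult) (measurable, simp add: nn_integral_completion real)
      also have "ennreal K * \<dots> = ennreal (K * I powr (s / a))"
        using K(1) real(1) by (cases "I = 0") (auto simp: ennreal_mult[symmetric] powr_diff)
      finally have "amalgam_norm M d r q p \<alpha> f \<le> ennpowr (ennreal (K * I powr (s / a))) (1 / s)"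
        unfolding amalgam_norm_def Let_def using a1 as \<open>p = ennreal s\<close>
        by (simp add: recip_ennreal ennpowr_mono)
      also have "\<dots> = ennreal (K powr (1 / s)) * Lnorm M \<alpha> f"
        using K(1) a1 as real a(1)
        by (subst ennpowr_ennreal)
          (simp_all add: Lnorm_ennreal ennpowr_ennreal powr_mult powr_powr ennreal_mult)
      finally show ?thesis .
    next
      case top
      then show ?thesis
        using K(1) a1 a(1) by (simp add: Lnorm_ennreal ennpowr_def ennreal_mult_top)
    qed
    then show ?thesis using K(1) by (intro exI[of _ "K powr (1 / s)"]) auto
  qed
qed

end
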